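(* Let $n,k\geq 1$ be integers, $V=\mathbb{R}^n$, and let $A=V\times (S^kV^*\otimes V)\to V$ be the trivial vector bundle with anchor $\rho\colon A\to TV$, $\rho(a)_x=a_x(x,\ldots,x)$. Then the product $\triangleright\colon\Gamma(A)\times\Gamma(A)\to\Gamma(A)$ given by $$a\triangleright b = D_{\rho(a)}b+\mathcal{P}_{\Lambda_a}b$$ defines a left-symmetric algebroid structure on the anchored vector bundle $(A,\rho)$ over $V$.
   Context: Setting. $V=\mathbb{R}^n$ is regarded as a smooth manifold with its canonical flat torsion-free connection $D$; $D$ also denotes the induced flat connections on all trivial tensor bundles over $V$ (so on sections of a trivial bundle $V\times W\to V$, viewed as smooth maps $V\to W$, $D_X$ is the componentwise directional derivative along the vector field $X$). Vector fields on $V$ are identified with smooth maps $V\to V$. The fiber $S^kV^*\otimes V$ is identified with the space of symmetric $k$-linear maps $V^k\to V$, so a section $a\in\Gamma(A)$ is a smooth family $x\mapsto a_x$ of symmetric $k$-linear maps $a_x\colon V^k\to V$; such a section is evaluated on vector fields pointwise. $\mathcal{E}$ denotes the Euler vector field, $\mathcal{E}_x=x$, so $\rho(a)=a(\mathcal{E},\ldots,\mathcal{E})$. For $a\in\Gamma(A)$, the endomorphism field $\Lambda_a\in C^\infty(V,\operatorname{End}(V))$ is $\Lambda_a(u)=a(\mathcal{E},\ldots,\mathcal{E},u)$ with $k-1$ entries $\mathcal{E}$, i.e. $(\Lambda_a)_x(u)=a_x(x,\ldots,x,u)$. For $\Phi\in C^\infty(V,\operatorname{End}(V))$, the operator $\mathcal{P}_\Phi\colon\Gamma(A)\to\Gamma(A)$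 is $$(\mathcal{P}_\Phi b)(u_1,\ldots,u_k)=\sum_{i=1}^k b(u_1,\ldots,u_{i-1},\Phi u_i,u_{i+1},\ldots,u_k).$$ Definition. Let $A\to M$ be an anchored vector bundle, i.e. a smooth vector bundle with a vector bundle map (anchor) $\rho\colon A\to TM$ over the identity. A left-symmetric algebroid structure on $A$ is an $\mathbb{R}$-bilinear product $\triangleright\colon\Gamma(A)\times\Gamma(A)\to\Gamma(A)$ such that for all $f\in C^\infty(M)$ and $a,b,c\in\Gamma(A)$: $(fa)\triangleright b=f(a\triangleright b)$; $a\triangleright(fb)=f(a\triangleright b)+\rho(a)[f]\,b$; and the associator $\operatorname{Ass}(a,b,c)=(a\triangleright b)\triangleright c-a\triangleright(b\triangleright c)$ satisfies $\operatorname{Ass}(a,b,c)=\operatorname{Ass}(b,a,c)$. *)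

theory Defs
  imports "HOL-Analysis.Analysis"
begin

section \<open>Smooth maps between normed spaces\<close>

text \<open>
  \<open>C_times m f\<close> says that \<open>f\<close> is of class $C^m$ on the whole space. Testing iterated derivatives
  direction by direction is adequate because all domains below are finite-dimensional.
\<close>

primrec C_times :: "nat \<Rightarrow> ('a::euclidean_space \<Rightarrow> 'b::real_normed_vector) \<Rightarrow> bool" where
  "C_times 0 f \<longleftrightarrow> continuous_on UNIV f"
| "C_times (Suc m) f \<longleftrightarrow>
     (\<forall>x. f differentiable (at x)) \<and> (\<forall>v. C_times m (\<lambda>x. frechet_derivative f (at x) v))"

definition smooth :: "('a::euclidean_space \<Rightarrow> 'b::real_normed_vector) \<Rightarrow> bool" where
  "smooth f \<longleftrightarrow> (\<forall>m. C_times m f)"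


section \<open>Left-symmetric algebroids on trivial bundles\<close>

text \<open>
  The trivial bundle with base \<open>'m\<close> and fibre \<open>'a\<close>, both Euclidean spaces. Its smooth sections are
  the smooth maps \<open>'m \<Rightarrow> 'a\<close>; since \<open>'m\<close> is a vector space, its tangent spaces are identified with
  \<open>'m\<close>, and an anchor is a fibrewise linear map \<open>\<rho> x :: 'a \<Rightarrow> 'm\<close> depending smoothly on \<open>x\<close>.
\<close>

locale anchored_trivial_bundle =
  fixes \<rho> :: "'m::euclidean_space \<Rightarrow> 'a::euclidean_space \<Rightarrow> 'm"
  assumes anchor_linear: "linear (\<rho> x)"
    and anchor_smooth: "smooth (\<lambda>(x, w). \<rho> x w)"

text \<open>The directional derivative of \<open>s\<close> along the vector field \<open>X\<close>, i.e. the flat connection.\<close>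

definition flat_D :: "('m::euclidean_space \<Rightarrow> 'm) \<Rightarrow> ('m \<Rightarrow> 'b::real_normed_vector) \<Rightarrow> 'm \<Rightarrow> 'b" where
  "flat_D X s = (\<lambda>x. frechet_derivative s (at x) (X x))"

definition associator :: "(('m \<Rightarrow> 'a) \<Rightarrow> ('m \<Rightarrow> 'a) \<Rightarrow> ('m \<Rightarrow> 'a::ab_group_add)) \<Rightarrow>
    ('m \<Rightarrow> 'a) \<Rightarrow> ('m \<Rightarrow> 'a) \<Rightarrow> ('m \<Rightarrow> 'a) \<Rightarrow> ('m \<Rightarrow> 'a)" where
  "associator T a b c = (\<lambda>x. T (T a b) c x - T a (T b c) x)"

text \<open>
  In HOL the product is a total function on all maps \<open>'m \<Rightarrow> 'a\<close>; only its restriction to smooth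
  sections is constrained.
\<close>

locale left_symmetric_algebroid = anchored_trivial_bundle \<rho>
  for \<rho> :: "'m::euclidean_space \<Rightarrow> 'a::euclidean_space \<Rightarrow> 'm" +
  fixes T :: "('m \<Rightarrow> 'a) \<Rightarrow> ('m \<Rightarrow> 'a) \<Rightarrow> ('m \<Rightarrow> 'a)"
  assumes closed: "\<lbrakk>smooth a; smooth b\<rbrakk> \<Longrightarrow> smooth (T a b)"
    and add_left: "\<lbrakk>smooth a; smooth b; smooth c\<rbrakk> \<Longrightarrow>
      T (\<lambda>x. a x + b x) c = (\<lambda>x. T a c x + T b c x)"
    and add_right: "\<lbrakk>smooth a; smooth b; smooth c\<rbrakk> \<Longrightarrow>
      T a (\<lambda>x. b x + c x) = (\<lambda>x. T a b x + T a c x)"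
    and scaleR_left: "\<lbrakk>smooth a; smooth b\<rbrakk> \<Longrightarrow> T (\<lambda>x. r *\<^sub>R a x) b = (\<lambda>x. r *\<^sub>R T a b x)"
    and scaleR_right: "\<lbrakk>smooth a; smooth b\<rbrakk> \<Longrightarrow> T a (\<lambda>x. r *\<^sub>R b x) = (\<lambda>x. r *\<^sub>R T a b x)"
    and function_left: "\<lbrakk>smooth f; smooth a; smooth b\<rbrakk> \<Longrightarrow>
      T (\<lambda>x. f x *\<^sub>R a x) b = (\<lambda>x. f x *\<^sub>R T a b x)"
    and Leibniz: "\<lbrakk>smooth f; smooth a; smooth b\<rbrakk> \<Longrightarrow>
      T a (\<lambda>x. f x *\<^sub>R b x) =
        (\<lambda>x. f x *\<^sub>R T a b x + flat_D (\<lambda>y. \<rho> y (a y)) f x *\<^sub>R b x)"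
    and left_symmetric: "\<lbrakk>smooth a; smooth b; smooth c\<rbrakk> \<Longrightarrow>
      associator T a b c = associator T b a c"


section \<open>The fibre of symmetric multilinear maps\<close>

definition multilinear :: "('v::real_vector ^ 'k \<Rightarrow> 'w::real_vector) \<Rightarrow> bool" where
  "multilinear f \<longleftrightarrow> (\<forall>i v. linear (\<lambda>u. f (\<chi> j. if j = i then u else v $ j)))"

definition symmetric_map :: "('v ^ 'k \<Rightarrow> 'w) \<Rightarrow> bool" where
  "symmetric_map f \<longleftrightarrow> (\<forall>p v. p permutes UNIV \<longrightarrow> f (\<chi> j. v $ p j) = f v)"

text \<open>
  With \<open>V = real ^ 'n\<close> and \<open>k = CARD('k)\<close>, this is the space of symmetric $k$-linear maps
  $V^k \to V$, that is, $S^k V^* \otimes V$.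
\<close>

typedef ('n, 'k) symlin =
  "{f :: (real ^ 'n) ^ 'k \<Rightarrow> real ^ 'n. multilinear f \<and> symmetric_map f}"
  morphisms ev Abs_symlin
proof
  show "(\<lambda>_. 0) \<in> {f :: (real ^ 'n) ^ 'k \<Rightarrow> real ^ 'n. multilinear f \<and> symmetric_map f}"
    by (simp add: multilinear_def symmetric_map_def linear_zero)
qed

setup_lifting type_definition_symlin

lemma multilinear_ev: "multilinear (ev f)" and symmetric_ev: "symmetric_map (ev f)"
  using ev[of f] by auto

instantiation symlin :: (finite, finite) real_vector
begin

lift_definition zero_symlin :: "('a, 'b) symlin" is "\<lambda>_. 0"
  by (simp add: multilinear_def symmetric_map_def linear_zero)

lift_definition plus_symlin :: "('a, 'b) symlin \<Rightarrow> ('a, 'b) symlin \<Rightarrow> ('a, 'b) symlin"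
  is "\<lambda>f g v. f v + g v"
  by (simp add: multilinear_def symmetric_map_def linear_compose_add)

lift_definition minus_symlin :: "('a, 'b) symlin \<Rightarrow> ('a, 'b) symlin \<Rightarrow> ('a, 'b) symlin"
  is "\<lambda>f g v. f v - g v"
  by (simp add: multilinear_def symmetric_map_def linear_compose_sub)

lift_definition uminus_symlin :: "('a, 'b) symlin \<Rightarrow> ('a, 'b) symlin"
  is "\<lambda>f v. - f v"
  by (simp add: multilinear_def symmetric_map_def linear_compose_neg)

lift_definition scaleR_symlin :: "real \<Rightarrow> ('a, 'b) symlin \<Rightarrow> ('a, 'b) symlin"
  is "\<lambda>r f v. r *\<^sub>R f v"
  by (simp add: multilinear_def symmetric_map_def linear_compose_scale_right)

instance
  by standard (transfer; simp add: fun_eq_iff algebra_simps)+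

end

lemma ev_add: "ev (f + g) v = ev f v + ev g v"
  and ev_scaleR: "ev (r *\<^sub>R f) v = r *\<^sub>R ev f v"
  and ev_zero: "ev 0 v = 0"
  by (transfer, simp)+

text \<open>
  The topology of the fibre is that of a finite-dimensional real vector space. It is obtained from
  the inner product that makes the array of coefficients \<open>coeffs\<close> an isometric embedding; as all
  norms on the fibre are equivalent, this choice affects neither smoothness nor derivatives.
\<close>

definition coeffs :: "('n::finite, 'k::finite) symlin \<Rightarrow> (real ^ 'n) ^ ('k \<Rightarrow> 'n)" where
  "coeffs f = (\<chi> s. ev f (\<chi> j. axis (s j) 1))"

lemma linear_coeffs: "linear coeffs"
  by (rule linearI) (simp_all add: coeffs_def vec_eq_iff ev_add ev_scaleR)

lemma multilinear_zero:
  fixes f :: "(real ^ 'n) ^ 'k::finite \<Rightarrow> real ^ 'n"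
  assumes f: "multilinear f" and 0: "\<And>s. f (\<chi> j. axis (s j) 1) = 0"
  shows "f v = 0"
proof -
  have "\<forall>v. (\<forall>i. i \<notin> S \<longrightarrow> (\<exists>j. v $ i = axis j 1)) \<longrightarrow> f v = 0" if "finite S" for S
    using that
  proof (induction S)
    case empty
    show ?case
    proof (intro allI impI)
      fix v :: "(real ^ 'n) ^ 'k"
      assume "\<forall>i. i \<notin> {} \<longrightarrow> (\<exists>j. v $ i = axis j 1)"
      then obtain s where "\<And>i. v $ i = axis (s i) 1" by (metis empty_iff)
      then have "v = (\<chi> j. axis (s j) 1)" by (simp add: vec_eq_iff)
      then show "f v = 0" using 0 by simp
    qed
  next
    case (insert i S)
    show ?case
    proof (intro allI impI)
      fix v :: "(real ^ 'n) ^ 'k"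
      assume v: "\<forall>j. j \<notin> insert i S \<longrightarrow> (\<exists>l. v $ j = axis l 1)"
      let ?u = "\<lambda>u. \<chi> j. if j = i then u else v $ j"
      have lin: "linear (\<lambda>u. f (?u u))"
        using f by (simp add: multilinear_def)
      have z: "f (?u (axis l 1)) = 0" for l
        by (rule insert.IH[rule_format]) (use v in auto)
      have vi: "v $ i = (\<Sum>l\<in>UNIV. (v $ i $ l) *\<^sub>R axis l 1)"
        using basis_expansion[of "v $ i"] by (simp add: scalar_mult_eq_scaleR)
      have "v = ?u (v $ i)" by (simp add: vec_eq_iff)
      then have "f v = f (?u (v $ i))" by metis
      also have "\<dots> = (\<Sum>l\<in>UNIV. (v $ i $ l) *\<^sub>R f (?u (axis l 1)))"
        by (subst vi) (simp only: linear_sum[OF lin] linear_cmul[OF lin])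
      finally show "f v = 0" by (simp add: z)
    qed
  qed
  from this[of UNIV] show ?thesis by simp
qed

lemma coeffs_eq_0_iff: "coeffs f = 0 \<longleftrightarrow> f = 0"
proof
  assume 0: "coeffs f = 0"
  have "ev f v = 0" for v
    by (rule multilinear_zero[OF multilinear_ev])
      (use 0 in \<open>simp add: coeffs_def vec_eq_iff\<close>)
  then show "f = 0" by (simp add: ev_inject[symmetric] fun_eq_iff ev_zero)
qed (simp add: linear_0[OF linear_coeffs])

lemma inj_coeffs: "inj coeffs"
  using linear_injective_0[OF linear_coeffs] coeffs_eq_0_iff by blast

instantiation symlin :: (finite, finite) real_inner
begin

definition inner_symlin :: "('a, 'b) symlin \<Rightarrow> ('a, 'b) symlin \<Rightarrow> real" where
  "inner_symlin f g = coeffs f \<bullet> coeffs g"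

definition norm_symlin :: "('a, 'b) symlin \<Rightarrow> real" where
  "norm_symlin f = norm (coeffs f)"

definition sgn_symlin :: "('a, 'b) symlin \<Rightarrow> ('a, 'b) symlin" where
  "sgn_symlin f = inverse (norm f) *\<^sub>R f"

definition dist_symlin :: "('a, 'b) symlin \<Rightarrow> ('a, 'b) symlin \<Rightarrow> real" where
  "dist_symlin f g = norm (f - g)"

definition uniformity_symlin :: "(('a, 'b) symlin \<times> ('a, 'b) symlin) filter" where
  "uniformity_symlin = (INF e\<in>{0<..}. principal {(f, g). dist f g < e})"

definition open_symlin :: "('a, 'b) symlin set \<Rightarrow> bool" where
  "open_symlin S \<longleftrightarrow> (\<forall>f\<in>S. \<forall>\<^sub>F (f', g) in uniformity. f' = f \<longrightarrow> g \<in> S)"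

instance
  by standard
    (simp_all add: inner_symlin_def norm_symlin_def sgn_symlin_def dist_symlin_def
      uniformity_symlin_def open_symlin_def inner_commute linear_add[OF linear_coeffs]
      linear_cmul[OF linear_coeffs] inner_add_left inner_add_right
      norm_eq_sqrt_inner coeffs_eq_0_iff)

end

lemma symlin_nontrivial: "\<exists>f :: ('n::finite, 'k::finite) symlin. f \<noteq> 0"
proof -
  obtain l :: 'n where True by simp
  define g :: "(real ^ 'n) ^ 'k \<Rightarrow> real ^ 'n"
    where "g v = (\<Prod>i\<in>UNIV. v $ i $ l) *\<^sub>R axis l 1" for v
  have "linear (\<lambda>u. g (\<chi> j. if j = i then u else v $ j))" for i v
  proof -
    have "g (\<chi> j. if j = i then u else v $ j)
        = (u $ l * (\<Prod>j\<in>UNIV - {i}. v $ j $ l)) *\<^sub>R axis l 1" for u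
      unfolding g_def by (subst prod.remove[of _ i]) (auto intro!: prod.cong)
    then show ?thesis
      by (auto intro!: linearI simp: algebra_simps)
  qed
  then have "multilinear g" by (simp add: multilinear_def)
  moreover have "symmetric_map g"
    unfolding symmetric_map_def
  proof (intro allI impI)
    fix p :: "'k \<Rightarrow> 'k" and v :: "(real ^ 'n) ^ 'k"
    assume "p permutes UNIV"
    then show "g (\<chi> j. v $ p j) = g v"
      using prod.permute[of p UNIV "\<lambda>i. v $ i $ l"] by (simp add: g_def comp_def)
  qed
  ultimately have "ev (Abs_symlin g) = g" by (simp add: Abs_symlin_inverse)
  moreover have "g (\<chi> j. axis l 1) \<noteq> 0" by (simp add: g_def axis_eq_0_iff)
  ultimately show ?thesis by (metis ev_zero)
qed

lemma symlin_orthonormal_basis: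
  "\<exists>B :: ('n::finite, 'k::finite) symlin set. B \<noteq> {} \<and> finite B \<and>
     (\<forall>u\<in>B. \<forall>v\<in>B. u \<bullet> v = (if u = v then 1 else 0)) \<and>
     (\<forall>x. (\<forall>u\<in>B. x \<bullet> u = 0) \<longleftrightarrow> x = 0)"
proof -
  let ?c = "coeffs :: ('n, 'k) symlin \<Rightarrow> _"
  have "subspace (range ?c)"
    by (simp add: linear_subspace_image[OF linear_coeffs])
  then obtain C where C: "C \<subseteq> range ?c" "pairwise orthogonal C" "\<And>x. x \<in> C \<Longrightarrow> norm x = 1"
      "independent C" "span C = range ?c"
    by (metis orthonormal_basis_subspace)
  define B where "B = ?c -` C"
  have CB: "C = ?c ` B" using C(1) by (auto simp: B_def)
  have "finite C" using C(4) by (simp add: independent_imp_finite)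
  then have fin: "finite B" unfolding B_def using inj_coeffs by (rule finite_vimageI)
  have ortho: "u \<bullet> v = (if u = v then 1 else 0)" if "u \<in> B" "v \<in> B" for u v
  proof -
    have "?c u \<bullet> ?c u = 1"
      using C(3)[of "?c u"] that by (simp add: CB dot_square_norm)
    moreover have "?c u \<bullet> ?c v = 0" if "u \<noteq> v"
      using C(2) \<open>u \<in> B\<close> \<open>v \<in> B\<close> that inj_coeffs
      by (auto simp: CB pairwise_def orthogonal_def dest: injD)
    ultimately show ?thesis by (auto simp: inner_symlin_def)
  qed
  have zero: "x = 0" if "\<forall>u\<in>B. x \<bullet> u = 0" for x
  proof -
    have "orthogonal (?c x) (?c x)"
    proof (rule orthogonal_to_span[of _ C])
      show "?c x \<in> span C" using C(5) by simp
      show "orthogonal (?c x) y" if "y \<in> C" for y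
        using that \<open>\<forall>u\<in>B. x \<bullet> u = 0\<close> by (auto simp: CB orthogonal_def inner_symlin_def)
    qed
    then show ?thesis by (simp add: orthogonal_def coeffs_eq_0_iff)
  qed
  have "B \<noteq> {}" using zero symlin_nontrivial by (metis empty_iff)
  with fin ortho zero show ?thesis by (intro exI[of _ B]) auto
qed

instantiation symlin :: (finite, finite) euclidean_space
begin

definition Basis_symlin :: "('a, 'b) symlin set" where
  "Basis_symlin = (SOME B. B \<noteq> {} \<and> finite B \<and>
     (\<forall>u\<in>B. \<forall>v\<in>B. u \<bullet> v = (if u = v then 1 else 0)) \<and>
     (\<forall>x. (\<forall>u\<in>B. x \<bullet> u = 0) \<longleftrightarrow> x = 0))"

instance
  using someI_ex[OF symlin_orthonormal_basis[where 'n = 'a and 'k = 'b], folded Basis_symlin_def]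
  by intro_classes auto

end


section \<open>The anchor and the product\<close>

definition sym_anchor :: "real ^ 'n \<Rightarrow> ('n::finite, 'k::finite) symlin \<Rightarrow> real ^ 'n" where
  "sym_anchor x w = ev w (\<chi> i. x)"

text \<open>
  \<open>\<Lambda> a x u\<close> is $a_x(x, \ldots, x, u)$. The slots are the elements of \<open>'k\<close>, so the last one is
  \<open>Max UNIV\<close>.
\<close>

lift_definition \<Lambda>_fib ::
  "('n::finite, 'k::{finite,linorder}) symlin \<Rightarrow> real ^ 'n \<Rightarrow> ((real ^ 'n) \<Rightarrow>\<^sub>L (real ^ 'n))"
  is "\<lambda>w x u. w (\<chi> i. if i = Max UNIV then u else x)"
proof -
  fix w :: "(real ^ 'n) ^ ('k::{finite,linorder}) \<Rightarrow> real ^ 'n" and x :: "real ^ 'n"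
  assume "multilinear w \<and> symmetric_map w"
  then have "linear (\<lambda>u. w (\<chi> j. if j = Max UNIV then u else (\<chi> i. x) $ j))"
    unfolding multilinear_def by blast
  then show "bounded_linear (\<lambda>u. w (\<chi> i. if i = Max UNIV then u else x))"
    by (simp add: linear_conv_bounded_linear cong: if_cong)
qed

definition \<Lambda> :: "(real ^ 'n \<Rightarrow> ('n::finite, 'k::{finite,linorder}) symlin) \<Rightarrow>
    real ^ 'n \<Rightarrow> ((real ^ 'n) \<Rightarrow>\<^sub>L (real ^ 'n))" where
  "\<Lambda> a = (\<lambda>x. \<Lambda>_fib (a x) x)"

lift_definition \<P>_fib ::
  "((real ^ 'n) \<Rightarrow>\<^sub>L (real ^ 'n)) \<Rightarrow> ('n::finite, 'k::finite) symlin \<Rightarrow> ('n, 'k) symlin"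
  is "\<lambda>\<Phi> b u. \<Sum>i\<in>UNIV. b (\<chi> j. if j = i then \<Phi> (u $ j) else u $ j)"
proof -
  fix \<Phi> :: "real ^ 'n \<Rightarrow> real ^ 'n" and b :: "(real ^ 'n) ^ 'k \<Rightarrow> real ^ 'n"
  assume bl: "bounded_linear \<Phi>" and b: "multilinear b \<and> symmetric_map b"
  let ?P = "\<lambda>u. \<Sum>i\<in>UNIV. b (\<chi> j. if j = i then \<Phi> (u $ j) else u $ j)"
  have "linear (\<lambda>u. ?P (\<chi> j. if j = l then u else v $ j))" for l v
  proof (rule linear_compose_sum, rule ballI)
    fix i
    let ?v = "\<chi> j. if j = i then \<Phi> (v $ j) else v $ j"
    have lin: "linear (\<lambda>u. b (\<chi> j. if j = l then u else ?v $ j))"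
      using b unfolding multilinear_def by blast
    show "linear (\<lambda>u. b (\<chi> j. if j = i then \<Phi> ((\<chi> j. if j = l then u else v $ j) $ j)
        else (\<chi> j. if j = l then u else v $ j) $ j))"
    proof (cases "i = l")
      case True
      have "(\<lambda>u. b (\<chi> j. if j = i then \<Phi> ((\<chi> j. if j = l then u else v $ j) $ j)
          else (\<chi> j. if j = l then u else v $ j) $ j))
        = (\<lambda>u. b (\<chi> j. if j = l then u else ?v $ j)) \<circ> \<Phi>"
        unfolding o_def
        by (intro ext arg_cong[where f = b]) (simp add: vec_eq_iff True)
      then show ?thesis
        using linear_compose[OF bounded_linear.linear[OF bl] lin] by simp
    next
      case False
      have "(\<lambda>u. b (\<chi> j. if j = i then \<Phi> ((\<chi> j. if j = l then u else v $ j) $ j)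
          else (\<chi> j. if j = l then u else v $ j) $ j))
        = (\<lambda>u. b (\<chi> j. if j = l then u else ?v $ j))"
        by (intro ext arg_cong[where f = b]) (use False in \<open>simp add: vec_eq_iff\<close>)
      then show ?thesis using lin by simp
    qed
  qed
  then have "multilinear ?P" by (simp add: multilinear_def)
  moreover have "?P (\<chi> j. v $ p j) = ?P v" if p: "p permutes UNIV" for p v
  proof -
    have "b (\<chi> j. if j = i then \<Phi> (v $ p j) else v $ p j)
        = b (\<chi> j. if j = p i then \<Phi> (v $ j) else v $ j)" for i
    proof -
      have "b (\<chi> j. (\<chi> j. if j = p i then \<Phi> (v $ j) else v $ j) $ p j)
          = b (\<chi> j. if j = p i then \<Phi> (v $ j) else v $ j)"
        using b p unfolding symmetric_map_def by blast
      moreover have "p j = p i \<longleftrightarrow> j = i" for j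
        using permutes_inj[OF p] by (auto simp: inj_eq)
      ultimately show ?thesis by simp
    qed
    then have "?P (\<chi> j. v $ p j) =
        (\<Sum>i\<in>UNIV. b (\<chi> j. if j = p i then \<Phi> (v $ j) else v $ j))"
      by (simp cong: if_cong)
    also have "\<dots> = ?P v"
      by (rule sum.reindex_bij_betw[OF permutes_imp_bij[OF p]])
    finally show ?thesis .
  qed
  ultimately show "multilinear ?P \<and> symmetric_map ?P" by (simp add: symmetric_map_def)
qed

definition \<P> :: "(real ^ 'n \<Rightarrow> ((real ^ 'n) \<Rightarrow>\<^sub>L (real ^ 'n))) \<Rightarrow>
    (real ^ 'n \<Rightarrow> ('n::finite, 'k::finite) symlin) \<Rightarrow> (real ^ 'n \<Rightarrow> ('n, 'k) symlin)" where
  "\<P> \<Phi> b = (\<lambda>x. \<P>_fib (\<Phi> x) (b x))"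

definition sym_product :: "(real ^ 'n \<Rightarrow> ('n::finite, 'k::{finite,linorder}) symlin) \<Rightarrow>
    (real ^ 'n \<Rightarrow> ('n, 'k) symlin) \<Rightarrow> (real ^ 'n \<Rightarrow> ('n, 'k) symlin)" where
  "sym_product a b = (\<lambda>x. flat_D (\<lambda>y. sym_anchor y (a y)) b x + \<P> (\<Lambda> a) b x)"

end

theory Submission
  imports Defs
begin

text \<open>
  Write \<open>X\<close> and \<open>Y\<close> for the anchors of \<open>a\<close> and \<open>b\<close>, and \<open>A\<close> and \<open>B\<close> for the endomorphism fields
  \<open>\<Lambda> a\<close> and \<open>\<Lambda> b\<close>. The algebraic axioms of a left-symmetric algebroid follow from the product rule
  and from the pointwise linearity of \<open>a \<mapsto> X\<close>, \<open>a \<mapsto> A\<close> and of the action \<open>\<P>\<close>. The issue is the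
  symmetry of the associator.

  The Euler field is the identity map, so its derivative along \<open>X\<close> is \<open>X\<close>, and \<open>A\<close> maps the Euler
  field to \<open>X\<close>. When $b(\mathcal{E}, \ldots, \mathcal{E})$ is differentiated along \<open>X\<close>, the terms in
  which an entry $\mathcal{E}$ is hit are therefore exactly those which $\mathcal{P}_A$ produces, so the
  anchor of the product of \<open>a\<close> and \<open>b\<close> is $D_X Y$ (\<open>sym_anchor_sym_product\<close>). The same computation for
  $b(\mathcal{E}, \ldots, \mathcal{E}, u)$ leaves one extra term, where \<open>A\<close> acts on the constant entry
  \<open>u\<close>: the endomorphism field of the product is $D_X B + B A$ (\<open>contraction_sym_product\<close>).

  Inserting both into the associator, everything that involves derivatives of \<open>a\<close> or \<open>b\<close> cancels, and
  \[ \mathrm{Ass}(a, b, c) = - D^2 c(X, Y) - (\mathcal{P}_A D_Y c + \mathcal{P}_B D_X c)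
       - (\mathcal{P}_A \mathcal{P}_B c - \mathcal{P}_{B A} c) \]
  (\<open>associator_sym_product\<close>). Each of the three terms is unchanged when \<open>a\<close> and \<open>b\<close> are exchanged: the
  first by the symmetry of second derivatives (\<open>deriv_at_deriv_at_commute\<close>), the second visibly,
  and the third because it is the sum, over ordered pairs of distinct slots, of \<open>c\<close> with \<open>A\<close> applied in
  the first slot and \<open>B\<close> in the second (\<open>slot_action_composition_defect_symmetric\<close>).

  For the analysis, endomorphisms are represented by matrices, so that all bundles have Euclidean
  fibres, and a multilinear map is expanded in its coefficients (\<open>ev_expansion\<close>); smoothness and
  derivatives of evaluations then reduce to finite sums of products of smooth functions.
\<close>

abbreviation deriv_at :: "('a::real_normed_vector \<Rightarrow> 'b::real_normed_vector) \<Rightarrow> 'a \<Rightarrow> 'a \<Rightarrow> 'b" where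
  "deriv_at f x \<equiv> frechet_derivative f (at x)"

section \<open>Calculus of smooth maps\<close>

lemma deriv_at_eqI: "(f has_derivative f') (at x) \<Longrightarrow> deriv_at f x = f'"
  by (rule frechet_derivative_at[symmetric])

text \<open>
  An introduction rule which takes the derivative in whatever form the differentiation rules deliver
  it, so that closure properties of class $C^m$ can be proved by induction on \<open>m\<close>.
\<close>

lemma C_times_SucI:
  assumes "\<And>x. (f has_derivative f' x) (at x)" "\<And>v. C_times m (\<lambda>x. f' x v)"
  shows "C_times (Suc m) f"
  using assms deriv_at_eqI[OF assms(1)] by (auto simp: differentiable_def)

lemma C_times_SucD:
  assumes "C_times (Suc m) f"
  shows "(f has_derivative deriv_at f x) (at x)" "C_times m (\<lambda>x. deriv_at f x v)"
  using assms by (auto simp: frechet_derivative_works)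

text \<open>
  The product rule for \<open>f\<close> and \<open>g\<close> involves \<open>f\<close> and \<open>g\<close> themselves next to their derivatives; the
  induction for bilinear maps below needs this step down for them.
\<close>

lemma C_times_mono_Suc: "C_times (Suc m) f \<Longrightarrow> C_times m f"
proof (induction m arbitrary: f)
  case 0
  then show ?case
    by (auto intro!: continuous_at_imp_continuous_on differentiable_imp_continuous_within)
next
  case (Suc m)
  show ?case
    by (rule C_times_SucI[OF C_times_SucD(1)[OF Suc.prems] Suc.IH[OF C_times_SucD(2)[OF Suc.prems]]])
qed

lemma C_times_const: "C_times m (\<lambda>x. c)"
proof (induction m arbitrary: c)
  case (Suc m)
  show ?case by (rule C_times_SucI[OF has_derivative_const Suc.IH])
qed (simp add: continuous_on_const)

lemma C_times_add: "C_times m f \<Longrightarrow> C_times m g \<Longrightarrow> C_times m (\<lambda>x. f x + g x)"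
proof (induction m arbitrary: f g)
  case (Suc m)
  show ?case
    by (rule C_times_SucI[OF has_derivative_add[OF C_times_SucD(1)[OF Suc.prems(1)] C_times_SucD(1)[OF Suc.prems(2)]]])
      (intro Suc.IH C_times_SucD Suc.prems)
qed (auto intro: continuous_intros)

lemma C_times_bounded_linear:
  assumes "bounded_linear L"
  shows "C_times m f \<Longrightarrow> C_times m (\<lambda>x. L (f x))"
proof (induction m arbitrary: f)
  case 0
  then show ?case by (simp add: bounded_linear.continuous_on[OF assms])
next
  case (Suc m)
  show ?case
    by (rule C_times_SucI[OF bounded_linear.has_derivative[OF assms C_times_SucD(1)[OF Suc.prems]]])
      (intro Suc.IH C_times_SucD Suc.prems)
qed

lemma C_times_bounded_bilinear:
  assumes "bounded_bilinear B"
  shows "C_times m f \<Longrightarrow> C_times m g \<Longrightarrow> C_times m (\<lambda>x. B (f x) (g x))"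
proof (induction m arbitrary: f g)
  case 0
  then show ?case by (simp add: bounded_bilinear.continuous_on[OF assms])
next
  case (Suc m)
  show ?case
    by (rule C_times_SucI[OF bounded_bilinear.FDERIV[OF assms C_times_SucD(1)[OF Suc.prems(1)] C_times_SucD(1)[OF Suc.prems(2)]]])
      (intro C_times_add Suc.IH C_times_SucD Suc.prems C_times_mono_Suc)
qed

lemma smooth_has_derivative: "smooth f \<Longrightarrow> (f has_derivative deriv_at f x) (at x)"
  unfolding smooth_def by (rule C_times_SucD(1)[of 0]) (rule spec)

lemma smooth_deriv_at: "smooth f \<Longrightarrow> smooth (\<lambda>x. deriv_at f x v)"
  unfolding smooth_def by (intro allI C_times_SucD(2)) (rule spec)

lemma smooth_continuous: "smooth f \<Longrightarrow> continuous_on UNIV f"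
  unfolding smooth_def by (subst C_times.simps(1)[symmetric]) (rule spec)

lemma smooth_linear_deriv_at: "smooth f \<Longrightarrow> linear (deriv_at f x)"
  by (rule bounded_linear.linear[OF has_derivative_bounded_linear[OF smooth_has_derivative]])

lemma smooth_const: "smooth (\<lambda>x. c)"
  by (simp add: smooth_def C_times_const)

lemma smooth_add: "smooth f \<Longrightarrow> smooth g \<Longrightarrow> smooth (\<lambda>x. f x + g x)"
  by (simp add: smooth_def C_times_add)

lemma smooth_bounded_linear: "bounded_linear L \<Longrightarrow> smooth f \<Longrightarrow> smooth (\<lambda>x. L (f x))"
  by (simp add: smooth_def C_times_bounded_linear)

lemma smooth_bounded_bilinear:
  "bounded_bilinear B \<Longrightarrow> smooth f \<Longrightarrow> smooth g \<Longrightarrow> smooth (\<lambda>x. B (f x) (g x))"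
  by (simp add: smooth_def C_times_bounded_bilinear)

lemma smooth_ident: "smooth (\<lambda>x. x)"
  unfolding smooth_def
proof
  fix m
  show "C_times m (\<lambda>x::'a. x)"
  proof (cases m)
    case (Suc m')
    then show ?thesis
      by (simp only: C_times_SucI[OF has_derivative_ident C_times_const])
  qed (simp add: continuous_on_id)
qed

lemma smooth_linear:
  fixes L :: "'a::euclidean_space \<Rightarrow> 'b::real_normed_vector"
  shows "linear L \<Longrightarrow> smooth f \<Longrightarrow> smooth (\<lambda>x. L (f x))"
  by (simp add: smooth_bounded_linear linear_conv_bounded_linear)

lemma smooth_scaleR: "smooth f \<Longrightarrow> smooth g \<Longrightarrow> smooth (\<lambda>x. f x *\<^sub>R g x)"
  by (rule smooth_bounded_bilinear[OF bounded_bilinear_scaleR])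

lemma smooth_sum: "(\<And>i. i \<in> I \<Longrightarrow> smooth (f i)) \<Longrightarrow> smooth (\<lambda>x. \<Sum>i\<in>I. f i x)"
  by (induction I rule: infinite_finite_induct) (simp_all add: smooth_const smooth_add)

lemma smooth_prod:
  fixes f :: "'i \<Rightarrow> 'a::euclidean_space \<Rightarrow> real"
  shows "(\<And>i. i \<in> I \<Longrightarrow> smooth (f i)) \<Longrightarrow> smooth (\<lambda>x. \<Prod>i\<in>I. f i x)"
  by (induction I rule: infinite_finite_induct)
    (simp_all add: smooth_const smooth_bounded_bilinear[OF bounded_bilinear_mult])

lemma smooth_vec_lambda:
  fixes f :: "'i::finite \<Rightarrow> 'a::euclidean_space \<Rightarrow> 'b::euclidean_space"
  assumes "\<And>i. smooth (f i)"
  shows "smooth (\<lambda>x. \<chi> i. f i x)"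
proof -
  have axis: "linear (axis i :: 'b \<Rightarrow> 'b ^ 'i)" for i
    by (rule linearI) (auto simp: axis_def vec_eq_iff)
  have "(\<chi> i. f i x) = (\<Sum>i\<in>UNIV. axis i (f i x))" for x
    by (simp add: vec_eq_iff axis_def sum_component)
  moreover have "smooth (\<lambda>x. \<Sum>i\<in>UNIV. axis i (f i x))"
    by (intro smooth_sum smooth_linear[OF axis] assms)
  ultimately show ?thesis by (simp only:)
qed

lemma deriv_at_basis_expansion:
  fixes f :: "'a::euclidean_space \<Rightarrow> 'b::real_normed_vector"
  assumes f: "smooth f"
  shows "deriv_at f y v = (\<Sum>i\<in>Basis. (v \<bullet> i) *\<^sub>R deriv_at f y i)"
  by (subst euclidean_representation[of v, symmetric])
    (simp only: linear_sum[OF smooth_linear_deriv_at[OF f]] linear_cmul[OF smooth_linear_deriv_at[OF f]])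

text \<open>
  The product rule for the pairing of the differential of \<open>f\<close> with a varying vector \<open>X y\<close>. Expanding
  \<open>X y\<close> in the basis turns the pairing into a sum of products of coordinates of \<open>X\<close> with partial
  derivatives of \<open>f\<close> in fixed directions, which are smooth again.
\<close>

lemma has_derivative_deriv_at_apply:
  fixes f :: "'a::euclidean_space \<Rightarrow> 'b::real_normed_vector"
  assumes f: "smooth f" and X: "(X has_derivative X') (at x)"
  shows "((\<lambda>y. deriv_at f y (X y)) has_derivative
    (\<lambda>h. deriv_at f x (X' h) + deriv_at (\<lambda>y. deriv_at f y (X x)) x h)) (at x)"
proof -
  note expand = deriv_at_basis_expansion[OF f]
  have D: "((\<lambda>y. \<Sum>i\<in>Basis. (X y \<bullet> i) *\<^sub>R deriv_at f y i) has_derivative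
     (\<lambda>h. \<Sum>i\<in>Basis. (X x \<bullet> i) *\<^sub>R deriv_at (\<lambda>y. deriv_at f y i) x h + (X' h \<bullet> i) *\<^sub>R deriv_at f x i)) (at x)"
    by (intro has_derivative_sum has_derivative_scaleR has_derivative_inner_left X
        smooth_has_derivative smooth_deriv_at f)
  have "((\<lambda>y. \<Sum>i\<in>Basis. (X x \<bullet> i) *\<^sub>R deriv_at f y i) has_derivative
     (\<lambda>h. \<Sum>i\<in>Basis. (X x \<bullet> i) *\<^sub>R deriv_at (\<lambda>y. deriv_at f y i) x h)) (at x)"
    by (intro has_derivative_sum has_derivative_scaleR_right smooth_has_derivative smooth_deriv_at f)
  then have "deriv_at (\<lambda>y. deriv_at f y (X x)) x
     = (\<lambda>h. \<Sum>i\<in>Basis. (X x \<bullet> i) *\<^sub>R deriv_at (\<lambda>y. deriv_at f y i) x h)"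
    by (subst expand) (rule deriv_at_eqI)
  with D show ?thesis
    by (subst expand) (simp add: sum.distrib add.commute expand[of x "X' _"])
qed

lemma smooth_deriv_at_apply:
  fixes f :: "'a::euclidean_space \<Rightarrow> 'b::real_normed_vector"
  assumes f: "smooth f" and X: "smooth X"
  shows "smooth (\<lambda>x. deriv_at f x (X x))"
proof -
  note expand = deriv_at_basis_expansion[OF f]
  show ?thesis
    by (subst expand) (intro smooth_sum smooth_scaleR smooth_deriv_at f
      smooth_bounded_linear[OF bounded_linear_inner_left] X)
qed


section \<open>Symmetry of second derivatives\<close>

text \<open>
  The mean value theorem is applied first in the direction \<open>u\<close>, to the difference of \<open>f\<close> along two
  parallel lines, and then in the direction \<open>v\<close>. The left-hand side is symmetric in \<open>u\<close> and \<open>v\<close>,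
  which is what makes the two mixed derivatives comparable.
\<close>

lemma second_difference_mean_value:
  fixes f :: "'a::euclidean_space \<Rightarrow> real"
  assumes f: "smooth f" and t: "0 < t"
  obtains p q where "0 < p" "p < t" "0 < q" "q < t"
    "f (x + t *\<^sub>R u + t *\<^sub>R v) - f (x + t *\<^sub>R u) - f (x + t *\<^sub>R v) + f x
      = t * t * deriv_at (\<lambda>y. deriv_at f y u) (x + p *\<^sub>R u + q *\<^sub>R v) v"
proof -
  have line: "((\<lambda>s. g (y + s *\<^sub>R w)) has_real_derivative deriv_at g (y + s *\<^sub>R w) w) (at s)"
    if g: "smooth g" for g :: "'a \<Rightarrow> real" and y w s
  proof -
    have "((\<lambda>s. y + s *\<^sub>R w) has_derivative (\<lambda>h. h *\<^sub>R w)) (at s)"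
      by (auto intro!: derivative_eq_intros)
    from has_derivative_compose[OF this smooth_has_derivative[OF g]]
    have "((\<lambda>s. g (y + s *\<^sub>R w)) has_derivative (\<lambda>h. deriv_at g (y + s *\<^sub>R w) (h *\<^sub>R w))) (at s)" .
    then show ?thesis
      by (simp add: has_field_derivative_def linear_cmul[OF smooth_linear_deriv_at[OF g]] mult_commute_abs)
  qed
  have "((\<lambda>s. f (x + t *\<^sub>R v + s *\<^sub>R u) - f (x + s *\<^sub>R u)) has_real_derivative
      deriv_at f (x + t *\<^sub>R v + s *\<^sub>R u) u - deriv_at f (x + s *\<^sub>R u) u) (at s)" for s
    by (intro DERIV_diff line f)
  from MVT2[OF t this] obtain p where p: "0 < p" "p < t" and
    1: "(f (x + t *\<^sub>R v + t *\<^sub>R u) - f (x + t *\<^sub>R u)) - (f (x + t *\<^sub>R v) - f x)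
      = t * (deriv_at f (x + t *\<^sub>R v + p *\<^sub>R u) u - deriv_at f (x + p *\<^sub>R u) u)"
    by auto
  from MVT2[OF t line[OF smooth_deriv_at[OF f]]] obtain q where q: "0 < q" "q < t" and
    2: "deriv_at f (x + p *\<^sub>R u + t *\<^sub>R v) u - deriv_at f (x + p *\<^sub>R u) u
      = t * deriv_at (\<lambda>y. deriv_at f y u) (x + p *\<^sub>R u + q *\<^sub>R v) v"
    by (metis (no_types, lifting) add.right_neutral diff_zero scale_zero_left)
  show thesis
    using that[OF p q] 1 2 by (simp add: add_ac algebra_simps)
qed

text \<open>
  By the second difference formula, used for \<open>(u, v)\<close> and for \<open>(v, u)\<close>, the two mixed derivatives
  agree up to a displacement of their arguments that is as small as desired; both are continuous.
\<close>

lemma deriv_at_deriv_at_commute_real: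
  fixes f :: "'a::euclidean_space \<Rightarrow> real"
  assumes f: "smooth f"
  shows "deriv_at (\<lambda>y. deriv_at f y u) x v = deriv_at (\<lambda>y. deriv_at f y v) x u"
proof -
  let ?F = "\<lambda>y. deriv_at (\<lambda>y. deriv_at f y u) y v"
  let ?G = "\<lambda>y. deriv_at (\<lambda>y. deriv_at f y v) y u"
  have "\<exists>p q p' q'. 0 < p \<and> p < t \<and> 0 < q \<and> q < t \<and> 0 < p' \<and> p' < t \<and> 0 < q' \<and> q' < t \<and>
      ?F (x + p *\<^sub>R u + q *\<^sub>R v) = ?G (x + p' *\<^sub>R v + q' *\<^sub>R u)" if t: "0 < t" for t :: real
  proof -
    obtain p q where 1: "0 < p" "p < t" "0 < q" "q < t"
      "f (x + t *\<^sub>R u + t *\<^sub>R v) - f (x + t *\<^sub>R u) - f (x + t *\<^sub>R v) + f x = t * t * ?F (x + p *\<^sub>R u + q *\<^sub>R v)"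
      by (rule second_difference_mean_value[OF f t])
    obtain p' q' where 2: "0 < p'" "p' < t" "0 < q'" "q' < t"
      "f (x + t *\<^sub>R v + t *\<^sub>R u) - f (x + t *\<^sub>R v) - f (x + t *\<^sub>R u) + f x = t * t * ?G (x + p' *\<^sub>R v + q' *\<^sub>R u)"
      by (rule second_difference_mean_value[OF f t])
    have "f (x + t *\<^sub>R v + t *\<^sub>R u) = f (x + t *\<^sub>R u + t *\<^sub>R v)"
      by (simp add: add_ac)
    then have "t * t * ?F (x + p *\<^sub>R u + q *\<^sub>R v) = t * t * ?G (x + p' *\<^sub>R v + q' *\<^sub>R u)"
      using 1(5) 2(5) by linarith
    then have "?F (x + p *\<^sub>R u + q *\<^sub>R v) = ?G (x + p' *\<^sub>R v + q' *\<^sub>R u)"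
      using t by simp
    then show ?thesis
      using 1(1-4) 2(1-4) by blast
  qed
  then have "\<forall>n. \<exists>p q p' q'. 0 < p \<and> p < inverse (real (Suc n)) \<and> 0 < q \<and> q < inverse (real (Suc n))
      \<and> 0 < p' \<and> p' < inverse (real (Suc n)) \<and> 0 < q' \<and> q' < inverse (real (Suc n)) \<and>
      ?F (x + p *\<^sub>R u + q *\<^sub>R v) = ?G (x + p' *\<^sub>R v + q' *\<^sub>R u)"
    by simp
  then obtain p q p' q' where bounds: "\<And>n. 0 < p n \<and> p n < inverse (real (Suc n))"
      "\<And>n. 0 < q n \<and> q n < inverse (real (Suc n))" "\<And>n. 0 < p' n \<and> p' n < inverse (real (Suc n))"
      "\<And>n. 0 < q' n \<and> q' n < inverse (real (Suc n))"
    and eq: "\<And>n. ?F (x + p n *\<^sub>R u + q n *\<^sub>R v) = ?G (x + p' n *\<^sub>R v + q' n *\<^sub>R u)"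
    by metis
  have null: "s \<longlonglongrightarrow> 0" if "\<And>n. 0 < s n \<and> s n < inverse (real (Suc n))" for s :: "nat \<Rightarrow> real"
    by (rule tendsto_sandwich[OF _ _ tendsto_const LIMSEQ_inverse_real_of_nat])
      (use that in \<open>auto intro!: always_eventually less_imp_le\<close>)
  have lim: "(\<lambda>n. H (x + s n *\<^sub>R w + r n *\<^sub>R z)) \<longlonglongrightarrow> H x"
    if H: "continuous_on UNIV H" and s: "s \<longlonglongrightarrow> 0" and r: "r \<longlonglongrightarrow> 0"
    for H :: "'a \<Rightarrow> real" and s r :: "nat \<Rightarrow> real" and w z
  proof -
    have "(\<lambda>n. x + s n *\<^sub>R w + r n *\<^sub>R z) \<longlonglongrightarrow> x + 0 *\<^sub>R w + 0 *\<^sub>R z"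
      by (intro tendsto_intros s r)
    then show ?thesis
      using continuous_on_tendsto_compose[OF H] by simp
  qed
  have "(\<lambda>n. ?F (x + p n *\<^sub>R u + q n *\<^sub>R v)) \<longlonglongrightarrow> ?F x"
    by (intro lim smooth_continuous smooth_deriv_at f null bounds)
  moreover have "(\<lambda>n. ?G (x + p' n *\<^sub>R v + q' n *\<^sub>R u)) \<longlonglongrightarrow> ?G x"
    by (intro lim smooth_continuous smooth_deriv_at f null bounds)
  ultimately show ?thesis
    unfolding eq by (rule LIMSEQ_unique)
qed

text \<open>
  The mean value theorem needs real values, hence the reduction to components.
\<close>

lemma deriv_at_deriv_at_commute:
  fixes f :: "'a::euclidean_space \<Rightarrow> 'b::euclidean_space"
  assumes f: "smooth f"
  shows "deriv_at (\<lambda>y. deriv_at f y u) x v = deriv_at (\<lambda>y. deriv_at f y v) x u"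
proof (rule euclidean_eqI)
  fix i :: 'b
  have inner: "deriv_at (\<lambda>y. g y \<bullet> i) x w = deriv_at g x w \<bullet> i" if "smooth g" for g :: "'a \<Rightarrow> 'b" and x w
    using deriv_at_eqI[OF has_derivative_inner_left[OF smooth_has_derivative[OF that]]] by simp
  have second: "deriv_at (\<lambda>y. deriv_at f y u) x v \<bullet> i
      = deriv_at (\<lambda>y. deriv_at (\<lambda>y. f y \<bullet> i) y u) x v" for u v
    by (simp add: inner f smooth_deriv_at)
  show "deriv_at (\<lambda>y. deriv_at f y u) x v \<bullet> i = deriv_at (\<lambda>y. deriv_at f y v) x u \<bullet> i"
    unfolding second
    by (intro deriv_at_deriv_at_commute_real smooth_bounded_linear[OF bounded_linear_inner_left] f)
qed


section \<open>Smooth families of symmetric multilinear maps\<close>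

lemma linear_ev_slot: "linear (\<lambda>u. ev w (\<chi> j. if j = i then u else v j))"
proof -
  have "linear (\<lambda>u. ev w (\<chi> j. if j = i then u else (\<chi> j. v j) $ j))"
    using multilinear_ev[of w] unfolding multilinear_def by blast
  then show ?thesis by (simp cong: if_cong)
qed

lemma linear_ev: "linear (\<lambda>w. ev w v)"
  by (rule linearI) (simp_all add: ev_add ev_scaleR)

lemma symlin_eqI: "(\<And>v. ev f v = ev g v) \<Longrightarrow> f = g"
  by (simp add: ev_inject[symmetric] fun_eq_iff)

text \<open>
  Both sides are multilinear in \<open>v\<close> and agree on tuples of basis vectors.
\<close>

lemma ev_expansion:
  fixes w :: "('n::finite, 'k::finite) symlin"
  shows "ev w v = (\<Sum>s\<in>UNIV. (\<Prod>j\<in>UNIV. v $ j $ s j) *\<^sub>R ev w (\<chi> j. axis (s j) 1))"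
proof -
  let ?g = "\<lambda>v. ev w v - (\<Sum>s\<in>UNIV. (\<Prod>j\<in>UNIV. v $ j $ s j) *\<^sub>R ev w (\<chi> j. axis (s j) 1))"
  have "linear (\<lambda>u. ?g (\<chi> j. if j = i then u else v $ j))" for i and v :: "(real ^ 'n) ^ 'k"
  proof (intro linear_compose_sub linear_compose_sum ballI linear_ev_slot)
    fix s :: "'k \<Rightarrow> 'n"
    have "(\<Prod>j\<in>UNIV. (\<chi> j. if j = i then u else v $ j) $ j $ s j)
        = u $ s i * (\<Prod>j\<in>UNIV - {i}. v $ j $ s j)" for u
      by (subst prod.remove[of _ i]) (auto intro!: prod.cong)
    then show "linear (\<lambda>u. (\<Prod>j\<in>UNIV. (\<chi> j. if j = i then u else v $ j) $ j $ s j) *\<^sub>R ev w (\<chi> j. axis (s j) 1))"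
      by (auto intro!: linearI simp: algebra_simps)
  qed
  then have "multilinear ?g" by (simp add: multilinear_def)
  moreover have "?g (\<chi> j. axis (s j) 1) = 0" for s
  proof -
    have "(\<Prod>j\<in>UNIV. (\<chi> j. axis (s j) (1::real)) $ j $ r j) = (if r = s then 1 else 0)" for r :: "'k \<Rightarrow> 'n"
      by (auto simp: axis_def fun_eq_iff)
    then show ?thesis by (simp add: if_distrib[of "\<lambda>t. t *\<^sub>R _"] cong: if_cong)
  qed
  ultimately have "?g v = 0" by (rule multilinear_zero)
  then show ?thesis by simp
qed

lemma smooth_ev:
  fixes b :: "'a::euclidean_space \<Rightarrow> ('n::finite, 'k::finite) symlin"
  assumes "smooth b" "\<And>j. smooth (u j)"
  shows "smooth (\<lambda>x. ev (b x) (\<chi> j. u j x))"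
proof -
  have "smooth (\<lambda>x. \<Sum>s\<in>UNIV. (\<Prod>j\<in>UNIV. u j x $ s j) *\<^sub>R ev (b x) (\<chi> j. axis (s j) 1))"
    by (intro smooth_sum smooth_scaleR smooth_prod smooth_linear[OF linear_ev] assms
      smooth_bounded_linear[OF bounded_linear_vec_nth])
  moreover have "(\<lambda>x. ev (b x) (\<chi> j. u j x))
      = (\<lambda>x. \<Sum>s\<in>UNIV. (\<Prod>j\<in>UNIV. u j x $ s j) *\<^sub>R ev (b x) (\<chi> j. axis (s j) 1))"
    by (rule ext, subst ev_expansion) simp
  ultimately show ?thesis by (simp only:)
qed

text \<open>
  The product rule for $b(u_1, \ldots, u_k)$. In each monomial of the coefficient expansion, the
  \<open>i\<close>-th term of the derivative of the product is the monomial for the tuple whose entry \<open>i\<close> has been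
  replaced by its derivative.
\<close>

lemma has_derivative_ev:
  fixes b :: "'a::euclidean_space \<Rightarrow> ('n::finite, 'k::finite) symlin"
  assumes b: "(b has_derivative b') (at x)" and u: "\<And>j. (u j has_derivative u' j) (at x)"
  shows "((\<lambda>y. ev (b y) (\<chi> j. u j y)) has_derivative
    (\<lambda>h. ev (b' h) (\<chi> j. u j x) + (\<Sum>i\<in>UNIV. ev (b x) (\<chi> j. if j = i then u' i h else u j x)))) (at x)"
proof -
  let ?e = "\<lambda>s. (\<chi> j. axis (s j) 1) :: (real ^ 'n) ^ 'k"
  have entry: "((\<lambda>y. u j y $ l) has_derivative (\<lambda>h. u' j h $ l)) (at x)" for j l
    by (rule bounded_linear.has_derivative[OF bounded_linear_vec_nth u])
  have evaluation: "((\<lambda>y. ev (b y) v) has_derivative (\<lambda>h. ev (b' h) v)) (at x)" for v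
    by (rule bounded_linear.has_derivative[OF linear_conv_bounded_linear[THEN iffD1, OF linear_ev] b])
  have *: "((\<lambda>y. \<Sum>s\<in>UNIV. (\<Prod>j\<in>UNIV. u j y $ s j) *\<^sub>R ev (b y) (?e s)) has_derivative
    (\<lambda>h. \<Sum>s\<in>UNIV. (\<Prod>j\<in>UNIV. u j x $ s j) *\<^sub>R ev (b' h) (?e s)
      + (\<Sum>i\<in>UNIV. u' i h $ s i * (\<Prod>j\<in>UNIV - {i}. u j x $ s j)) *\<^sub>R ev (b x) (?e s))) (at x)"
    by (intro has_derivative_sum has_derivative_scaleR has_derivative_prod entry evaluation)
  have slot: "ev (b x) (\<chi> j. if j = i then u' i h else u j x)
      = (\<Sum>s\<in>UNIV. (u' i h $ s i * (\<Prod>j\<in>UNIV - {i}. u j x $ s j)) *\<^sub>R ev (b x) (?e s))" for i h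
    by (subst ev_expansion, subst prod.remove[of UNIV i]) auto
  have "(\<lambda>y. ev (b y) (\<chi> j. u j y)) = (\<lambda>y. \<Sum>s\<in>UNIV. (\<Prod>j\<in>UNIV. u j y $ s j) *\<^sub>R ev (b y) (?e s))"
    by (rule ext, subst ev_expansion) simp
  moreover have "(\<lambda>h. ev (b' h) (\<chi> j. u j x) + (\<Sum>i\<in>UNIV. ev (b x) (\<chi> j. if j = i then u' i h else u j x)))
     = (\<lambda>h. \<Sum>s\<in>UNIV. (\<Prod>j\<in>UNIV. u j x $ s j) *\<^sub>R ev (b' h) (?e s)
      + (\<Sum>i\<in>UNIV. u' i h $ s i * (\<Prod>j\<in>UNIV - {i}. u j x $ s j)) *\<^sub>R ev (b x) (?e s))"
    unfolding slot
    by (rule ext, subst ev_expansion, subst sum.swap) (simp add: sum.distrib scaleR_sum_left)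
  ultimately show ?thesis using * by simp
qed


section \<open>The action of endomorphisms on the fibre\<close>

text \<open>
  The operator \<open>\<P>_fib\<close> with a matrix in place of a bounded operator: both arguments then
  range over Euclidean spaces, where bilinear maps are automatically bounded.
\<close>

definition slot_action :: "real ^ 'n ^ 'n \<Rightarrow> ('n::finite, 'k::finite) symlin \<Rightarrow> ('n, 'k) symlin" where
  "slot_action A b = \<P>_fib (Blinfun ((*v) A)) b"

lemma ev_slot_action:
  "ev (slot_action A b) u = (\<Sum>i\<in>UNIV. ev b (\<chi> j. if j = i then A *v (u $ j) else u $ j))"
  by (simp add: slot_action_def \<P>_fib.rep_eq bounded_linear_Blinfun_apply cong: if_cong)

lemma bounded_bilinear_slot_action:
  "bounded_bilinear (slot_action :: _ \<Rightarrow> ('n::finite, 'k::finite) symlin \<Rightarrow> _)"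
proof -
  have "linear (\<lambda>A. slot_action A b)" for b :: "('n, 'k) symlin"
  proof (rule linearI; rule symlin_eqI)
    fix A B :: "real ^ 'n ^ 'n" and r u
    show "ev (slot_action (A + B) b) u = ev (slot_action A b + slot_action B b) u"
      unfolding ev_add ev_slot_action sum.distrib[symmetric]
      by (rule sum.cong[OF refl])
        (simp add: matrix_vector_mult_add_rdistrib linear_add[OF linear_ev_slot, symmetric] cong: if_cong)
    show "ev (slot_action (r *\<^sub>R A) b) u = ev (r *\<^sub>R slot_action A b) u"
      unfolding ev_scaleR ev_slot_action scaleR_sum_right
      by (rule sum.cong[OF refl])
        (simp add: scaleR_matrix_vector_assoc[symmetric] linear_cmul[OF linear_ev_slot, symmetric] cong: if_cong)
  qed
  moreover have "linear (slot_action A :: ('n, 'k) symlin \<Rightarrow> _)" for A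
    by (rule linearI; rule symlin_eqI)
      (simp_all add: ev_slot_action ev_add ev_scaleR sum.distrib scaleR_sum_right)
  ultimately show ?thesis
    by (simp add: bilinear_conv_bounded_bilinear[symmetric] bilinear_def)
qed

text \<open>
  In \<open>slot_action A (slot_action B c)\<close> the matrices hit slots \<open>i\<close> and \<open>l\<close> independently. The terms with
  \<open>i = l\<close> make up \<open>slot_action (B ** A) c\<close>: the order is reversed because the outer operator is the
  first to transform the argument. The terms with \<open>i \<noteq> l\<close> are symmetric, since exchanging \<open>A\<close> and
  \<open>B\<close> amounts to exchanging \<open>i\<close> and \<open>l\<close>.
\<close>

lemma slot_action_composition_defect_symmetric:
  "slot_action A (slot_action B c) - slot_action (B ** A) c
    = slot_action B (slot_action A c) - slot_action (A ** B) c"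
proof -
  let ?two = "\<lambda>A B i l u. ev c (\<chi> j. if j = l then B *v (u $ j) else if j = i then A *v (u $ j) else u $ j)"
  have defect: "ev (slot_action A (slot_action B c)) u
      = ev (slot_action (B ** A) c) u + (\<Sum>i\<in>UNIV. \<Sum>l\<in>UNIV - {i}. ?two A B i l u)" for A B u
  proof -
    have "ev (slot_action A (slot_action B c)) u = (\<Sum>i\<in>UNIV. \<Sum>l\<in>UNIV.
       ev c (\<chi> j. if j = l then B *v (if j = i then A *v (u $ j) else u $ j)
         else if j = i then A *v (u $ j) else u $ j))"
      by (simp add: ev_slot_action cong: if_cong)
    also have "\<dots> = (\<Sum>i\<in>UNIV. ev c (\<chi> j. if j = i then (B ** A) *v (u $ j) else u $ j)
        + (\<Sum>l\<in>UNIV - {i}. ?two A B i l u))"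
    proof (rule sum.cong[OF refl])
      fix i
      show "(\<Sum>l\<in>UNIV. ev c (\<chi> j. if j = l then B *v (if j = i then A *v (u $ j) else u $ j)
           else if j = i then A *v (u $ j) else u $ j))
         = ev c (\<chi> j. if j = i then (B ** A) *v (u $ j) else u $ j)
          + (\<Sum>l\<in>UNIV - {i}. ?two A B i l u)"
      proof (subst sum.remove[of _ i], simp, simp, rule arg_cong2[where f = "(+)"])
        show "ev c (\<chi> j. if j = i then B *v (if j = i then A *v (u $ j) else u $ j)
             else if j = i then A *v (u $ j) else u $ j)
           = ev c (\<chi> j. if j = i then (B ** A) *v (u $ j) else u $ j)"
          by (rule arg_cong[where f = "ev c"], subst vec_eq_iff) (simp add: matrix_vector_mul_assoc)
        show "(\<Sum>l\<in>UNIV - {i}. ev c (\<chi> j. if j = l then B *v (if j = i then A *v (u $ j) else u $ j)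
             else if j = i then A *v (u $ j) else u $ j)) = (\<Sum>l\<in>UNIV - {i}. ?two A B i l u)"
          by (intro sum.cong refl arg_cong[where f = "ev c"], subst vec_eq_iff) auto
      qed
    qed
    finally show ?thesis by (simp add: sum.distrib ev_slot_action)
  qed
  have swap: "(\<Sum>i\<in>UNIV. \<Sum>l\<in>UNIV - {i}. ?two A B i l u) = (\<Sum>i\<in>UNIV. \<Sum>l\<in>UNIV - {i}. ?two B A i l u)" for u
  proof -
    have "?two A B i l u = ?two B A l i u" if "i \<noteq> l" for i l
      using that by (intro arg_cong[where f = "ev c"], subst vec_eq_iff) auto
    then have "(\<Sum>i\<in>UNIV. \<Sum>l\<in>UNIV - {i}. ?two A B i l u) = (\<Sum>i\<in>UNIV. \<Sum>l | l \<noteq> i. ?two B A l i u)"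
      by (auto intro!: sum.cong)
    also have "\<dots> = (\<Sum>l\<in>UNIV. \<Sum>i | l \<noteq> i. ?two B A l i u)"
      using sum.swap_restrict[of UNIV UNIV "\<lambda>i l. ?two B A l i u" "\<lambda>i l. l \<noteq> i"] by simp
    also have "\<dots> = (\<Sum>i\<in>UNIV. \<Sum>l\<in>UNIV - {i}. ?two B A i l u)"
      by (auto intro!: sum.cong)
    finally show ?thesis .
  qed
  have "ev (slot_action A (slot_action B c) + slot_action (A ** B) c) u
      = ev (slot_action B (slot_action A c) + slot_action (B ** A) c) u" for u
    unfolding ev_add defect swap by simp
  then have "slot_action A (slot_action B c) + slot_action (A ** B) c
      = slot_action B (slot_action A c) + slot_action (B ** A) c"
    by (rule symlin_eqI)
  then show ?thesis by (simp add: algebra_simps)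
qed

lemma matrix_blinfun_mult:
  fixes \<Phi> :: "(real ^ 'n) \<Rightarrow>\<^sub>L (real ^ 'm)"
  shows "matrix (blinfun_apply \<Phi>) *v u = blinfun_apply \<Phi> u"
  by (simp add: matrix_works bounded_linear.linear[OF blinfun.bounded_linear_right])

definition contraction :: "real ^ 'n \<Rightarrow> ('n::finite, 'k::{finite,linorder}) symlin \<Rightarrow> real ^ 'n ^ 'n" where
  "contraction x w = matrix (blinfun_apply (\<Lambda>_fib w x))"

lemma contraction_mult: "contraction x w *v u = ev w (\<chi> j. if j = Max UNIV then u else x)"
  unfolding contraction_def by (subst matrix_blinfun_mult) (simp only: \<Lambda>_fib.rep_eq)

text \<open>
  This links the two ingredients of the product: the action of \<open>\<Lambda> a\<close> on an Euler entry produces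
  the anchor of \<open>a\<close>, which is also the derivative of the Euler field along that anchor.
\<close>

lemma contraction_self: "contraction x w *v x = sym_anchor x w"
  by (simp add: contraction_mult sym_anchor_def)

lemma sym_product_eq:
  fixes a b :: "real ^ 'n \<Rightarrow> ('n::finite, 'k::{finite,linorder}) symlin"
  shows "sym_product a b x = deriv_at b x (sym_anchor x (a x)) + slot_action (contraction x (a x)) (b x)"
proof -
  have "Blinfun ((*v) (matrix (blinfun_apply \<Phi>))) = \<Phi>" for \<Phi> :: "(real ^ 'n) \<Rightarrow>\<^sub>L (real ^ 'n)"
    by (subst ext[OF matrix_blinfun_mult]) (rule blinfun_apply_inverse)
  then show ?thesis
    by (simp add: sym_product_def flat_D_def \<P>_def \<Lambda>_def slot_action_def contraction_def)
qed

lemma linear_sym_anchor: "linear (sym_anchor x)"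
  unfolding sym_anchor_def by (rule linear_ev)

lemma linear_contraction: "linear (contraction x)"
  by (rule linearI)
    (simp_all add: matrix_eq contraction_mult matrix_vector_mult_add_rdistrib ev_add ev_scaleR
      scaleR_matrix_vector_assoc[symmetric])

lemma smooth_sym_anchor:
  fixes a :: "'a::euclidean_space \<Rightarrow> ('n::finite, 'k::finite) symlin"
  shows "smooth X \<Longrightarrow> smooth a \<Longrightarrow> smooth (\<lambda>y. sym_anchor (X y) (a y))"
  unfolding sym_anchor_def by (intro smooth_ev)

lemma smooth_contraction:
  fixes a :: "real ^ 'n \<Rightarrow> ('n::finite, 'k::{finite,linorder}) symlin"
  assumes "smooth a"
  shows "smooth (\<lambda>y. contraction y (a y))"
proof -
  have "contraction x w = (\<chi> i l. ev w (\<chi> j. if j = Max UNIV then axis l 1 else x) $ i)" for x :: "real ^ 'n" and w :: "('n, 'k) symlin"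
    by (simp add: contraction_def matrix_def \<Lambda>_fib.rep_eq)
  moreover have "smooth (\<lambda>y. \<chi> i l. ev (a y) (\<chi> j. if j = Max UNIV then axis l 1 else y) $ i)"
  proof (intro smooth_vec_lambda smooth_bounded_linear[OF bounded_linear_vec_nth] smooth_ev assms)
    show "smooth (\<lambda>y. if j = Max UNIV then axis l 1 else y)" for j :: 'k and l :: 'n
      by (cases "j = Max UNIV") (simp_all add: smooth_const smooth_ident)
  qed
  ultimately show ?thesis by (simp only:)
qed

lemma smooth_sym_product:
  assumes "smooth a" "smooth b"
  shows "smooth (sym_product a b)"
proof -
  have "smooth (\<lambda>x. sym_product a b x)"
    unfolding sym_product_eq
    by (intro smooth_add smooth_deriv_at_apply smooth_sym_anchor smooth_ident assms
        smooth_bounded_bilinear[OF bounded_bilinear_slot_action] smooth_contraction)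
  then show ?thesis .
qed


section \<open>The associator\<close>

text \<open>
  Differentiating the \<open>k\<close> entries \<open>y\<close> of \<open>b y (y, \<dots>, y)\<close> along \<open>X\<close> puts \<open>X\<close> into each slot in turn; by
  \<open>contraction_self\<close> so does the action of \<open>\<Lambda> a\<close>.
\<close>

lemma sym_anchor_sym_product:
  fixes a b :: "real ^ 'n \<Rightarrow> ('n::finite, 'k::{finite,linorder}) symlin"
  assumes b: "smooth b"
  shows "sym_anchor x (sym_product a b x) = deriv_at (\<lambda>y. sym_anchor y (b y)) x (sym_anchor x (a x))"
proof -
  have "deriv_at (\<lambda>y. sym_anchor y (b y)) x =
     (\<lambda>h. ev (deriv_at b x h) (\<chi> j. x) + (\<Sum>i\<in>UNIV. ev (b x) (\<chi> j. if j = i then h else x)))"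
    unfolding sym_anchor_def
    by (intro deriv_at_eqI has_derivative_ev smooth_has_derivative b has_derivative_ident)
  then show ?thesis
    by (simp add: sym_product_eq sym_anchor_def[of x "_ + _"] ev_add ev_slot_action contraction_self cong: if_cong)
qed

text \<open>
  As for the anchor, but the last entry of \<open>b y (y, \<dots>, y, u)\<close> is constant. In that slot the derivative
  contributes nothing, while the action of \<open>\<Lambda> a\<close> contributes \<open>b x (x, \<dots>, x, \<Lambda> a u)\<close>, which is the
  product of the two matrices applied to \<open>u\<close>.
\<close>

lemma contraction_sym_product:
  fixes a b :: "real ^ 'n \<Rightarrow> ('n::finite, 'k::{finite,linorder}) symlin"
  assumes b: "smooth b"
  shows "contraction x (sym_product a b x)
    = deriv_at (\<lambda>y. contraction y (b y)) x (sym_anchor x (a x))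
      + contraction x (b x) ** contraction x (a x)"
proof -
  let ?M = "Max UNIV :: 'k" and ?X = "sym_anchor x (a x)"
  show ?thesis
    unfolding matrix_eq
  proof
    fix u
    have "((\<lambda>y. ev (b y) (\<chi> j. if j = ?M then u else y)) has_derivative
       (\<lambda>h. ev (deriv_at b x h) (\<chi> j. if j = ?M then u else x)
        + (\<Sum>i\<in>UNIV. ev (b x) (\<chi> j. if j = i then if i = ?M then 0 else h else if j = ?M then u else x)))) (at x)"
    proof (rule has_derivative_ev[OF smooth_has_derivative[OF b]])
      show "((\<lambda>y. if j = ?M then u else y) has_derivative (\<lambda>h. if j = ?M then 0 else h)) (at x)" for j
        by (cases "j = ?M") simp_all
    qed
    moreover have "((\<lambda>y. contraction y (b y) *v u) has_derivative
        (\<lambda>h. deriv_at (\<lambda>y. contraction y (b y)) x h *v u)) (at x)"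
    proof (rule bounded_linear.has_derivative[OF _ smooth_has_derivative[OF smooth_contraction[OF b]]])
      have "linear (\<lambda>A :: real ^ 'n ^ 'n. A *v u)"
        by (rule linearI) (simp_all add: matrix_vector_mult_add_rdistrib scaleR_matrix_vector_assoc[symmetric])
      then show "bounded_linear (\<lambda>A :: real ^ 'n ^ 'n. A *v u)"
        by (simp only: linear_conv_bounded_linear)
    qed
    then have "((\<lambda>y. ev (b y) (\<chi> j. if j = ?M then u else y)) has_derivative
        (\<lambda>h. deriv_at (\<lambda>y. contraction y (b y)) x h *v u)) (at x)"
      by (simp only: contraction_mult)
    ultimately have D: "deriv_at (\<lambda>y. contraction y (b y)) x ?X *v u =
        ev (deriv_at b x ?X) (\<chi> j. if j = ?M then u else x)
        + (\<Sum>i\<in>UNIV. ev (b x) (\<chi> j. if j = i then if i = ?M then 0 else ?X else if j = ?M then u else x))"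
      by (rule fun_cong[OF has_derivative_unique, rotated])
    \<comment> \<open>The zero in the last slot is the derivative of the constant entry \<open>u\<close>.\<close>
    have slot: "ev (b x) (\<chi> j. if j = i then contraction x (a x) *v (if j = ?M then u else x) else if j = ?M then u else x)
      = ev (b x) (\<chi> j. if j = i then if i = ?M then 0 else ?X else if j = ?M then u else x)
       + (if i = ?M then contraction x (b x) *v (contraction x (a x) *v u) else 0)" for i
    proof (cases "i = ?M")
      case True
      then show ?thesis
        using linear_0[OF linear_ev_slot[of "b x" ?M "\<lambda>j. x"]]
        by (simp add: contraction_mult[of x "b x"] cong: if_cong)
    next
      case False
      then show ?thesis
        by (simp, intro arg_cong[where f = "ev (b x)"], subst vec_eq_iff) (simp add: contraction_self)
    qed
    have "contraction x (sym_product a b x) *v u = ev (deriv_at b x ?X) (\<chi> j. if j = ?M then u else x)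
        + (\<Sum>i\<in>UNIV. ev (b x) (\<chi> j. if j = i then contraction x (a x) *v (if j = ?M then u else x) else if j = ?M then u else x))"
      by (rule trans[OF contraction_mult]) (simp only: sym_product_eq ev_add ev_slot_action vec_lambda_beta)
    also have "\<dots> = deriv_at (\<lambda>y. contraction y (b y)) x ?X *v u
        + contraction x (b x) *v (contraction x (a x) *v u)"
      unfolding slot D by (simp add: sum.distrib)
    finally show "contraction x (sym_product a b x) *v u
      = (deriv_at (\<lambda>y. contraction y (b y)) x ?X + contraction x (b x) ** contraction x (a x)) *v u"
      by (simp only: matrix_vector_mult_add_rdistrib matrix_vector_mul_assoc)
  qed
qed

text \<open>
  The derivatives of \<open>Y\<close> and of \<open>B\<close> along \<open>X\<close> occur in both halves of the associator, on the left
  through the anchor and the endomorphism field of the product and on the right through the product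
  rule, and cancel. What remains involves \<open>a\<close> and \<open>b\<close> only through their values at \<open>x\<close>.
\<close>

lemma associator_sym_product:
  fixes a b c :: "real ^ 'n \<Rightarrow> ('n::finite, 'k::{finite,linorder}) symlin"
  assumes a: "smooth a" and b: "smooth b" and c: "smooth c"
  defines "X \<equiv> \<lambda>x. sym_anchor x (a x)" and "Y \<equiv> \<lambda>x. sym_anchor x (b x)"
    and "A \<equiv> \<lambda>x. contraction x (a x)" and "B \<equiv> \<lambda>x. contraction x (b x)"
  shows "associator sym_product a b c x =
    - deriv_at (\<lambda>y. deriv_at c y (Y x)) x (X x)
    - (slot_action (A x) (deriv_at c x (Y x)) + slot_action (B x) (deriv_at c x (X x)))
    - (slot_action (A x) (slot_action (B x) (c x)) - slot_action (B x ** A x) (c x))"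
proof -
  note bb = bounded_bilinear_slot_action
  have Y: "smooth Y" and B: "smooth B"
    unfolding Y_def B_def by (intro smooth_sym_anchor smooth_contraction smooth_ident b)+
  have "((\<lambda>y. deriv_at c y (Y y) + slot_action (B y) (c y)) has_derivative
      (\<lambda>h. (deriv_at c x (deriv_at Y x h) + deriv_at (\<lambda>y. deriv_at c y (Y x)) x h)
        + (slot_action (B x) (deriv_at c x h) + slot_action (deriv_at B x h) (c x)))) (at x)"
    by (intro has_derivative_add has_derivative_deriv_at_apply bounded_bilinear.FDERIV[OF bb]
        smooth_has_derivative c Y B)
  moreover have "sym_product b c = (\<lambda>y. deriv_at c y (Y y) + slot_action (B y) (c y))"
    by (simp add: fun_eq_iff sym_product_eq Y_def B_def)
  ultimately have "deriv_at (sym_product b c) x (X x) =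
      deriv_at c x (deriv_at Y x (X x)) + deriv_at (\<lambda>y. deriv_at c y (Y x)) x (X x)
        + (slot_action (B x) (deriv_at c x (X x)) + slot_action (deriv_at B x (X x)) (c x))"
    by (simp add: deriv_at_eqI)
  then have right: "sym_product a (sym_product b c) x =
      deriv_at c x (deriv_at Y x (X x)) + deriv_at (\<lambda>y. deriv_at c y (Y x)) x (X x)
        + (slot_action (B x) (deriv_at c x (X x)) + slot_action (deriv_at B x (X x)) (c x))
        + (slot_action (A x) (deriv_at c x (Y x)) + slot_action (A x) (slot_action (B x) (c x)))"
    by (simp add: sym_product_eq[of _ _ x] X_def A_def Y_def B_def bounded_bilinear.add_right[OF bb])
  have left: "sym_product (sym_product a b) c x =
      deriv_at c x (deriv_at Y x (X x)) + (slot_action (deriv_at B x (X x)) (c x) + slot_action (B x ** A x) (c x))"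
    by (subst sym_product_eq)
      (simp add: sym_anchor_sym_product contraction_sym_product b X_def A_def Y_def B_def bounded_bilinear.add_left[OF bb])
  show ?thesis
    unfolding associator_def left right by (simp add: algebra_simps)
qed

theorem theorem2p3:
  shows "left_symmetric_algebroid
    (sym_anchor :: real ^ 'n \<Rightarrow> ('n::finite, 'k::{finite,linorder}) symlin \<Rightarrow> real ^ 'n)
    (sym_product :: (real ^ 'n \<Rightarrow> ('n, 'k) symlin) \<Rightarrow> (real ^ 'n \<Rightarrow> ('n, 'k) symlin) \<Rightarrow>
      (real ^ 'n \<Rightarrow> ('n, 'k) symlin))"
proof (intro left_symmetric_algebroid.intro left_symmetric_algebroid_axioms.intro
    anchored_trivial_bundle.intro)
  note bb = bounded_bilinear_slot_action
  note slot = bounded_bilinear.add_left[OF bb] bounded_bilinear.add_right[OF bb]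
    bounded_bilinear.scaleR_left[OF bb] bounded_bilinear.scaleR_right[OF bb]
  note lin = linear_add[OF linear_sym_anchor] linear_cmul[OF linear_sym_anchor]
    linear_add[OF linear_contraction] linear_cmul[OF linear_contraction]
  note deriv_lin = linear_add[OF smooth_linear_deriv_at] linear_cmul[OF smooth_linear_deriv_at]
  show "linear (sym_anchor x :: ('n, 'k) symlin \<Rightarrow> _)" for x
    by (rule linear_sym_anchor)
  show "smooth (\<lambda>(x, w :: ('n, 'k) symlin). sym_anchor x w)"
    unfolding case_prod_unfold
    by (intro smooth_sym_anchor smooth_bounded_linear[OF bounded_linear_fst]
        smooth_bounded_linear[OF bounded_linear_snd] smooth_ident)
  fix a b c :: "real ^ 'n \<Rightarrow> ('n, 'k) symlin" and f :: "real ^ 'n \<Rightarrow> real" and r :: real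
  assume a: "smooth a" and b: "smooth b"
  show "smooth (sym_product a b)"
    by (rule smooth_sym_product[OF a b])
  show "sym_product (\<lambda>x. r *\<^sub>R a x) b = (\<lambda>x. r *\<^sub>R sym_product a b x)"
    by (simp add: fun_eq_iff sym_product_eq lin slot deriv_lin b scaleR_add_right)
  show "sym_product a (\<lambda>x. r *\<^sub>R b x) = (\<lambda>x. r *\<^sub>R sym_product a b x)"
    by (simp add: fun_eq_iff sym_product_eq slot scaleR_add_right
        deriv_at_eqI[OF has_derivative_scaleR_right[OF smooth_has_derivative[OF b]]])
  {
    assume f: "smooth f"
    show "sym_product (\<lambda>x. f x *\<^sub>R a x) b = (\<lambda>x. f x *\<^sub>R sym_product a b x)"
      by (simp add: fun_eq_iff sym_product_eq lin slot deriv_lin b scaleR_add_right)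
    show "sym_product a (\<lambda>x. f x *\<^sub>R b x) = (\<lambda>x. f x *\<^sub>R sym_product a b x
        + flat_D (\<lambda>y. sym_anchor y (a y)) f x *\<^sub>R b x)"
      by (simp add: fun_eq_iff sym_product_eq slot scaleR_add_right flat_D_def
          deriv_at_eqI[OF has_derivative_scaleR[OF smooth_has_derivative[OF f] smooth_has_derivative[OF b]]])
  }
  assume c: "smooth c"
  show "sym_product (\<lambda>x. a x + b x) c = (\<lambda>x. sym_product a c x + sym_product b c x)"
    by (simp add: fun_eq_iff sym_product_eq lin slot deriv_lin c)
  show "sym_product a (\<lambda>x. b x + c x) = (\<lambda>x. sym_product a b x + sym_product a c x)"
    by (simp add: fun_eq_iff sym_product_eq slot
        deriv_at_eqI[OF has_derivative_add[OF smooth_has_derivative[OF b] smooth_has_derivative[OF c]]])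
  show "associator sym_product a b c = associator sym_product b a c"
  proof
    fix x
    show "associator sym_product a b c x = associator sym_product b a c x"
      unfolding associator_sym_product[OF a b c] associator_sym_product[OF b a c]
        slot_action_composition_defect_symmetric[of "contraction x (a x)"]
      by (subst deriv_at_deriv_at_commute[OF c]) simp
  qed
qed

end
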